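(* Let $Q_n$ be the $n$-dimensional hypercube graph. Then $\mathrm{USN}(Q_n) < 3n + O(\log n)$ as $n\to\infty$; that is, there exist constants $C>0$ and $n_0$ such that $\mathrm{USN}(Q_n) < 3n + C\log n$ for all $n\ge n_0$.
   Context: Graphs are finite, simple and undirected. The hypercube $Q_n$ has the $2^n$ subsets of $\{1,\dots,n\}$ as vertices, two being adjacent when their symmetric difference has exactly one element. A valid labelling of a graph $G$ with universe a finite set $S$ assigns to the vertices of $G$ pairwise distinct nonempty subsets of $S$ such that two distinct vertices are adjacent if and only if their labels are disjoint. The universe size number $\mathrm{USN}(G)$ is the minimum of $|S|$ over all finite sets $S$ for which $G$ has a valid labelling with universe $S$. *)

theory Defs
  imports Complex_Main "Graph_Theory.Pair_Digraph"
begin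

text \<open>
  Finite simple undirected graphs are the library's \<^locale>\<open>pair_graph\<close>s: finite, loop-free,
  symmetric relations \<^term>\<open>parcs G\<close> on \<^term>\<open>pverts G\<close>.
\<close>

definition hypercube :: "nat \<Rightarrow> nat set pair_pre_digraph" where
  "hypercube n = \<lparr> pverts = Pow {1..n},
     parcs = {(A, B). A \<in> Pow {1..n} \<and> B \<in> Pow {1..n} \<and> card (sym_diff A B) = 1} \<rparr>"

definition valid_labelling :: "'a pair_pre_digraph \<Rightarrow> 'b set \<Rightarrow> ('a \<Rightarrow> 'b set) \<Rightarrow> bool" where
  "valid_labelling G S l \<longleftrightarrow>
     finite S \<and>
     (\<forall>v \<in> pverts G. l v \<subseteq> S \<and> l v \<noteq> {}) \<and>
     inj_on l (pverts G) \<and>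
     (\<forall>u \<in> pverts G. \<forall>v \<in> pverts G. u \<noteq> v \<longrightarrow> ((u, v) \<in> parcs G \<longleftrightarrow> l u \<inter> l v = {}))"

text \<open>
  Only universes of natural numbers are considered, because a constant cannot quantify over the
  element type of \<open>S\<close>. By \<open>USN_le\<close> below, universes of any other type give no smaller value, and by
  \<open>USN_attained\<close> the minimum exists for every finite simple graph.
\<close>

definition USN :: "'a pair_pre_digraph \<Rightarrow> nat" where
  "USN G = (LEAST k. \<exists>(S :: nat set) l. valid_labelling G S l \<and> card S = k)"

lemma pair_graph_hypercube: "pair_graph (hypercube n)"
proof
  show "finite (pverts (hypercube n))" by (simp add: hypercube_def)
  have "parcs (hypercube n) \<subseteq> Pow {1..n} \<times> Pow {1..n}"
    by (auto simp: hypercube_def)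
  then show "finite (parcs (hypercube n))"
    by (rule finite_subset) simp
  show "symmetric (hypercube n)"
    by (auto simp: symmetric_def sym_def hypercube_def Un_commute arcs_ends_def arc_to_ends_def)
qed (auto simp: hypercube_def)

lemma valid_labelling_nat:
  fixes S :: "'b set"
  assumes "valid_labelling G S l"
  shows "\<exists>(T :: nat set) l'. valid_labelling G T l' \<and> card T = card S"
proof -
  have fin: "finite S" and sub: "\<And>v. v \<in> pverts G \<Longrightarrow> l v \<subseteq> S"
    using assms by (auto simp: valid_labelling_def)
  obtain f :: "'b \<Rightarrow> nat" where f: "inj_on f S"
    using finite_imp_inj_to_nat_seg[OF fin] by blast
  have dis: "f ` l u \<inter> f ` l v = {} \<longleftrightarrow> l u \<inter> l v = {}"
    if "u \<in> pverts G" "v \<in> pverts G" for u v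
    using inj_on_image_Int[OF f sub sub, OF that] by (metis image_is_empty)
  have "inj_on (\<lambda>v. f ` l v) (pverts G)"
    using assms inj_on_image_eq_iff[OF f sub sub]
    by (auto simp: valid_labelling_def inj_on_def)
  then have "valid_labelling G (f ` S) (\<lambda>v. f ` l v)"
    using assms dis by (auto simp: valid_labelling_def image_mono)
  then show ?thesis using card_image[OF f] by blast
qed

lemma USN_le: "valid_labelling G S l \<Longrightarrow> USN G \<le> card S"
  unfolding USN_def by (rule Least_le) (rule valid_labelling_nat)

lemma USN_attained:
  assumes "pair_graph G"
  shows "\<exists>(S :: nat set) l. valid_labelling G S l \<and> card S = USN G"
proof -
  interpret pair_graph G by fact
  define N where "N = {{u, v} | u v. u \<in> pverts G \<and> v \<in> pverts G \<and> (u, v) \<notin> parcs G}"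
  define l where "l = (\<lambda>v. {e \<in> N. v \<in> e})"
  have sym: "(v, u) \<in> parcs G" if "(u, v) \<in> parcs G" for u v
    using that arcs_symmetric by blast
  have "N \<subseteq> Pow (pverts G)" by (auto simp: N_def)
  then have fin: "finite N" by (rule finite_subset) simp
  have single: "{v} \<in> l v" if "v \<in> pverts G" for v
    using that no_loops' by (fastforce simp: l_def N_def)
  have inj: "inj_on l (pverts G)"
  proof (rule inj_onI)
    fix u v assume "u \<in> pverts G" "l u = l v"
    then have "{u} \<in> l v" using single by blast
    then show "u = v" by (simp add: l_def)
  qed
  have adj: "(u, v) \<in> parcs G \<longleftrightarrow> l u \<inter> l v = {}"
    if uv: "u \<in> pverts G" "v \<in> pverts G" "u \<noteq> v" for u v
  proof
    assume e: "(u, v) \<in> parcs G"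
    show "l u \<inter> l v = {}"
    proof (rule ccontr)
      assume "l u \<inter> l v \<noteq> {}"
      then obtain a b where "(a, b) \<notin> parcs G" "u \<in> {a, b}" "v \<in> {a, b}"
        by (auto simp: l_def N_def)
      then show False using e sym uv by auto
    qed
  next
    assume "l u \<inter> l v = {}"
    then have "{u, v} \<notin> N" by (auto simp: l_def)
    then show "(u, v) \<in> parcs G" using uv by (auto simp: N_def)
  qed
  have "valid_labelling G N l"
  proof -
    have "l v \<subseteq> N" "l v \<noteq> {}" if "v \<in> pverts G" for v
      using single[OF that] by (auto simp: l_def)
    then show ?thesis unfolding valid_labelling_def using fin inj adj by blast
  qed
  then have "\<exists>k. \<exists>(S :: nat set) l. valid_labelling G S l \<and> card S = k"
    using valid_labelling_nat by blast
  then show ?thesis unfolding USN_def by (rule LeastI_ex)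
qed

end

theory Submission
  imports Defs
begin

text \<open>
  A labelling amounts to a family of independent sets covering all pairs of distinct non-adjacent
  vertices. Take two such vertices \<open>A\<close> and \<open>B\<close> of the cube. If \<open>card B = card A + 1\<close>, then some
  \<open>i \<in> A\<close> is missing from \<open>B\<close>, and the pair lies in the set of all \<open>X\<close> such that either
  \<open>card X \<equiv> card A\<close> modulo 3 and \<open>i \<in> X\<close>, or \<open>card X \<equiv> card A + 1\<close> modulo 3 and \<open>i \<notin> X\<close>.
  There are \<open>3 * n\<close> such sets, and they are independent. If the cardinalities do not differ by one,
  use sets of the form \<open>{X. card X \<in> W}\<close>, where \<open>W\<close> has no two consecutive elements. For
  cardinalities \<open>2 * p\<close> and \<open>2 * q + 1\<close>, the binary reflected Gray code provides
  logarithmically many such \<open>W\<close>: the code words of \<open>q\<close> and \<open>q + 1\<close> differ in a single bit \<open>j\<close>,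
  and the code word of \<open>p\<close>, differing from both, must differ from them in a bit other than \<open>j\<close>.
\<close>

text \<open>Each vertex is labelled by the members of \<open>F\<close> that contain it, so two
  labels meet exactly when one member contains both vertices.\<close>

lemma USN_le_card_independent_cover:
  assumes "finite F"
    and independent: "\<And>I u v. I \<in> F \<Longrightarrow> u \<in> I \<Longrightarrow> v \<in> I \<Longrightarrow> (u, v) \<notin> parcs G"
    and covered: "\<And>u v. u \<in> pverts G \<Longrightarrow> v \<in> pverts G \<Longrightarrow> u \<noteq> v \<Longrightarrow> (u, v) \<notin> parcs G
      \<Longrightarrow> \<exists>I\<in>F. u \<in> I \<and> v \<in> I"
    and nonempty: "\<And>v. v \<in> pverts G \<Longrightarrow> \<exists>I\<in>F. v \<in> I"
    and separated: "\<And>u v. u \<in> pverts G \<Longrightarrow> v \<in> pverts G \<Longrightarrow> u \<noteq> v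
      \<Longrightarrow> \<exists>I\<in>F. (u \<in> I) \<noteq> (v \<in> I)"
  shows "USN G \<le> card F"
proof (rule USN_le)
  define l where "l v = {I \<in> F. v \<in> I}" for v
  have "inj_on l (pverts G)"
  proof (rule inj_onI, rule ccontr)
    fix u v assume *: "u \<in> pverts G" "v \<in> pverts G" "l u = l v" "u \<noteq> v"
    then show False using separated[of u v] by (auto simp: l_def)
  qed
  moreover have "(u, v) \<in> parcs G \<longleftrightarrow> l u \<inter> l v = {}"
    if "u \<in> pverts G" "v \<in> pverts G" "u \<noteq> v" for u v
    using covered[OF that] independent[of _ u v] by (auto simp: l_def)
  moreover have "l v \<subseteq> F \<and> l v \<noteq> {}" if "v \<in> pverts G" for v
    using nonempty[OF that] by (auto simp: l_def)
  ultimately show "valid_labelling G F l"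
    using \<open>finite F\<close> by (simp add: valid_labelling_def)
qed

subsection \<open>The Gray code\<close>

text \<open>Bit \<open>k\<close> of the code word: with \<open>a = p div 2 ^ k\<close>, the number
  \<open>(a + 1) div 2\<close> is odd iff \<open>a mod 4\<close> is 1 or 2, that is, iff bits
  \<open>k\<close> and \<open>k + 1\<close> of \<open>p\<close> differ.\<close>

definition gray :: "nat \<Rightarrow> nat \<Rightarrow> bool" where
  "gray k p \<longleftrightarrow> odd ((p div 2 ^ k + 1) div 2)"

lemma gray_changeE:
  assumes "gray k p \<noteq> gray k (Suc p)"
  obtains a where "Suc p = 2 ^ k * a" "odd a"
proof -
  define a where "a = Suc p div 2 ^ k"
  have "Suc p div 2 ^ k \<noteq> p div 2 ^ k"
    using assms by (auto simp: gray_def)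
  then have dvd: "Suc p mod 2 ^ k = 0" and a: "a = Suc (p div 2 ^ k)"
    by (auto simp: a_def div_Suc split: if_splits)
  have "Suc p = 2 ^ k * a"
    using dvd unfolding a_def by (metis add.right_neutral mult_div_mod_eq)
  moreover have "odd a"
  proof
    assume "even a"
    then have "(a + 1) div 2 = a div 2" by simp
    then show False using assms a by (simp add: gray_def flip: a_def)
  qed
  ultimately show thesis by (rule that)
qed

text \<open>By \<open>gray_changeE\<close>, the index of a changing bit is the exponent of 2 in
  \<open>Suc p\<close>.\<close>

lemma gray_change_unique:
  assumes "gray k p \<noteq> gray k (Suc p)" "gray j p \<noteq> gray j (Suc p)"
  shows "k = j"
proof -
  have le: "k \<le> j" if changes: "gray k p \<noteq> gray k (Suc p)" "gray j p \<noteq> gray j (Suc p)" for k j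
  proof (rule ccontr)
    assume "\<not> k \<le> j"
    obtain a where a: "Suc p = 2 ^ k * a" "odd a" using gray_changeE[OF changes(1)] .
    obtain b where b: "Suc p = 2 ^ j * b" "odd b" using gray_changeE[OF changes(2)] .
    have "(2::nat) ^ k = 2 ^ j * (2 * 2 ^ (k - j - 1))"
      using \<open>\<not> k \<le> j\<close> by (simp flip: power_add power.power_Suc)
    then have "b = 2 * 2 ^ (k - j - 1) * a"
      using a(1) b(1) by (simp add: mult.assoc)
    then show False using b(2) by simp
  qed
  show ?thesis using le[OF assms] le[OF assms(2,1)] by simp
qed

text \<open>Decoding runs from the leading bit down: \<open>p div 2 ^ k\<close> is determined by its
  half, known from the step before, and Gray bit \<open>k\<close>.\<close>

lemma gray_inject:
  assumes "p < 2 ^ K" "q < 2 ^ K" and eq: "\<And>k. k < K \<Longrightarrow> gray k p = gray k q"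
  shows "p = q"
proof -
  have "p div 2 ^ (K - d) = q div 2 ^ (K - d)" if "d \<le> K" for d
    using that
  proof (induction d)
    case 0
    then show ?case using assms(1,2) by simp
  next
    case (Suc d)
    define a b where "a = p div 2 ^ (K - Suc d)" and "b = q div 2 ^ (K - Suc d)"
    have "K - d = Suc (K - Suc d)" using Suc.prems by simp
    then have "a div 2 = b div 2"
      using Suc by (simp add: a_def b_def div_mult2_eq mult.commute[of 2])
    moreover have "even ((a + 1) div 2) = even ((b + 1) div 2)"
      using eq[of "K - Suc d"] Suc.prems by (simp add: gray_def a_def b_def)
    ultimately have "a = b"
      by (cases "even a"; cases "even b") (auto elim!: evenE oddE)
    then show ?case by (simp add: a_def b_def)
  qed
  from this[of K] show ?thesis by simp
qed

lemma gray_separates: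
  assumes "p < 2 ^ K" "q + 1 < 2 ^ K" "p \<noteq> q" "p \<noteq> q + 1"
  obtains k where "k < K" "gray k q = gray k (q + 1)" "gray k p \<noteq> gray k q"
proof -
  obtain j where j: "j < K" "gray j p \<noteq> gray j q"
    using gray_inject[of p K q] assms by auto
  obtain i where i: "i < K" "gray i p \<noteq> gray i (q + 1)"
    using gray_inject[of p K "q + 1"] assms by auto
  show thesis
  proof (cases "gray j q = gray j (q + 1)")
    case True
    then show thesis using j that by blast
  next
    case False
    \<comment> \<open>Bits are two-valued: \<open>p\<close> differs from \<open>q\<close> in bit
      \<open>j\<close>, so it agrees there with \<open>q + 1\<close>, unlike in bit
      \<open>i\<close>.\<close>
    then have "j \<noteq> i" using i j by auto
    then have "gray i q = gray i (q + 1)"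
      using gray_change_unique[of j q i] False by auto
    then show thesis using i that by blast
  qed
qed

subsection \<open>Independent sets of cardinalities\<close>

definition levels :: "nat \<Rightarrow> bool \<Rightarrow> nat set" where
  "levels k b = {w. if even w then gray k (w div 2) = b
     else gray k (w div 2) \<noteq> b \<and> gray k (w div 2 + 1) \<noteq> b}"

text \<open>The two parity classes serve pairs of equal parity, the sets \<open>levels k b\<close>
  those of mixed parity.\<close>

definition level_family :: "nat \<Rightarrow> nat set set" where
  "level_family K = {Collect even, Collect odd} \<union> (\<lambda>(k, b). levels k b) ` ({..<K} \<times> UNIV)"

lemma finite_level_family: "finite (level_family K)"
  by (simp add: level_family_def)

lemma card_level_family: "card (level_family K) \<le> 2 * K + 2"
proof -
  have "card ((\<lambda>(k, b). levels k b) ` ({..<K} \<times> UNIV)) \<le> card ({..<K} \<times> (UNIV :: bool set))"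
    by (rule card_image_le) simp
  moreover have "card {Collect even, Collect (odd :: nat \<Rightarrow> bool)} \<le> 2"
    by (simp add: card_insert_if)
  ultimately show ?thesis
    using card_Un_le[of "{Collect even, Collect odd}" "(\<lambda>(k, b). levels k b) ` ({..<K} \<times> UNIV)"]
    by (simp add: level_family_def)
qed

lemma level_family_no_consecutive:
  assumes "W \<in> level_family K" "w \<in> W"
  shows "Suc w \<notin> W"
proof -
  have "Suc w \<notin> levels k b" if "w \<in> levels k b" for k b
  proof (cases "even w")
    case True
    then show ?thesis using that by (auto simp: levels_def)
  next
    case False
    then have "Suc w div 2 = w div 2 + 1" by presburger
    then show ?thesis using that False by (auto simp: levels_def)
  qed
  then show ?thesis using assms by (auto simp: level_family_def)
qed

lemma level_family_covers:
  assumes "a < 2 ^ K" "b < 2 ^ K" "1 < K" "a \<noteq> Suc b" "b \<noteq> Suc a"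
  shows "\<exists>W\<in>level_family K. a \<in> W \<and> b \<in> W"
proof -
  have mixed: "\<exists>W\<in>level_family K. a \<in> W \<and> b \<in> W"
    if "a < 2 ^ K" "b < 2 ^ K" "a \<noteq> Suc b" "b \<noteq> Suc a" "even a" "odd b" for a b
  proof -
    obtain p where p: "a = 2 * p" using \<open>even a\<close> by (elim evenE)
    obtain q where q: "b = 2 * q + 1" using \<open>odd b\<close> by (elim oddE)
    have "(2::nat) ^ 2 \<le> 2 ^ K" using \<open>1 < K\<close> by (intro power_increasing) auto
    \<comment> \<open>The neighbours of \<open>b\<close> are \<open>2 * q\<close> and
      \<open>2 * (q + 1)\<close>, and \<open>a\<close> is neither.\<close>
    then have "p < 2 ^ K" "q + 1 < 2 ^ K" "p \<noteq> q" "p \<noteq> q + 1"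
      using that p q by auto
    then obtain k where k: "k < K" "gray k q = gray k (q + 1)" "gray k p \<noteq> gray k q"
      by (rule gray_separates)
    have "a \<in> levels k (gray k p)" "b \<in> levels k (gray k p)"
      using k(2,3) by (auto simp: levels_def p q)
    moreover have "levels k (gray k p) \<in> level_family K"
      using k(1) by (auto simp: level_family_def)
    ultimately show ?thesis by blast
  qed
  show ?thesis
  proof (cases "even a = even b")
    case True
    then show ?thesis by (auto simp: level_family_def)
  next
    case False
    then show ?thesis using mixed[of a b] mixed[of b a] assms by blast
  qed
qed

subsection \<open>Covering the non-edges of the cube\<close>

text \<open>Modulo 2, class \<open>c + 1\<close> would be followed by class \<open>c\<close> again,
  and adding \<open>i\<close> to a member without it would give an adjacent member. Modulo 3, an
  edge could only go up from class \<open>c\<close> to \<open>c + 1\<close>, which would lose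
  \<open>i\<close>.\<close>

definition coord_set :: "nat \<Rightarrow> nat \<Rightarrow> nat \<Rightarrow> nat set set" where
  "coord_set n i c = {A \<in> Pow {1..n}.
     card A mod 3 = c \<and> i \<in> A \<or> card A mod 3 = (c + 1) mod 3 \<and> i \<notin> A}"

text \<open>
  The member \<open>{{}}\<close> is needed for injectivity: if 3 divides \<open>n + 1\<close>, the sets \<open>coord_set n i c\<close> do
  not separate \<open>{}\<close> from \<open>{1..n}\<close>.
\<close>

definition cube_cover :: "nat \<Rightarrow> nat \<Rightarrow> nat set set set" where
  "cube_cover n K = (\<lambda>(i, c). coord_set n i c) ` ({1..n} \<times> {..<3})
     \<union> (\<lambda>W. {A \<in> Pow {1..n}. card A \<in> W}) ` level_family K \<union> {{{}}}"

lemma finite_cube_cover: "finite (cube_cover n K)"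
  by (simp add: cube_cover_def finite_level_family)

lemma card_cube_cover: "card (cube_cover n K) \<le> 3 * n + 2 * K + 3"
proof -
  let ?A = "(\<lambda>(i, c). coord_set n i c) ` ({1..n} \<times> {..<3})"
  let ?B = "(\<lambda>W. {A \<in> Pow {1..n}. card A \<in> W}) ` level_family K"
  have "card ?A \<le> card ({1..n} \<times> {..<3::nat})"
    by (rule card_image_le) simp
  moreover have "card ?B \<le> card (level_family K)"
    by (rule card_image_le) (rule finite_level_family)
  moreover have "card (?A \<union> ?B \<union> {{{}}}) \<le> card ?A + card ?B + 1"
    using card_Un_le[of "?A \<union> ?B" "{{{}}}"] card_Un_le[of ?A ?B] by simp
  ultimately show ?thesis
    using card_level_family[of K] unfolding cube_cover_def by simp
qed

lemma hypercube_arc_iff: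
  "(A, B) \<in> parcs (hypercube n) \<longleftrightarrow> A \<subseteq> {1..n} \<and> B \<subseteq> {1..n} \<and>
     (A \<subseteq> B \<and> card B = Suc (card A) \<or> B \<subseteq> A \<and> card A = Suc (card B))"
proof (cases "A \<subseteq> {1..n} \<and> B \<subseteq> {1..n}")
  case True
  then have fin: "finite A" "finite B" by (auto intro: finite_subset)
  have "card (sym_diff A B) = card (A - B) + card (B - A)"
    using fin by (intro card_Un_disjoint) auto
  moreover have "card A = card (A \<inter> B) + card (A - B)" "card B = card (A \<inter> B) + card (B - A)"
    using fin card_Int_Diff[of A B] card_Int_Diff[of B A] by (simp_all add: Int_commute)
  moreover have "A \<subseteq> B \<longleftrightarrow> card (A - B) = 0" "B \<subseteq> A \<longleftrightarrow> card (B - A) = 0"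
    using fin by auto
  ultimately have "card (sym_diff A B) = 1 \<longleftrightarrow>
      A \<subseteq> B \<and> card B = Suc (card A) \<or> B \<subseteq> A \<and> card A = Suc (card B)"
    by linarith
  then show ?thesis using True by (simp add: hypercube_def)
qed (auto simp: hypercube_def)

lemma cube_cover_independent:
  assumes "I \<in> cube_cover n K" "A \<in> I" "B \<in> I"
  shows "(A, B) \<notin> parcs (hypercube n)"
proof -
  have "\<not> (A \<subseteq> B \<and> card B = Suc (card A))" if mem: "A \<in> I" "B \<in> I" for A B
  proof
    assume *: "A \<subseteq> B \<and> card B = Suc (card A)"
    consider i c where "c < 3" "I = coord_set n i c"
      | W where "W \<in> level_family K" "I = {A \<in> Pow {1..n}. card A \<in> W}"
      | "I = {{}}"
      using assms(1) by (auto simp: cube_cover_def)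
    then show False
    proof cases
      case 1
      then consider "card A mod 3 = card B mod 3"
        | "card A mod 3 = c" "card B mod 3 = (c + 1) mod 3" "i \<in> A" "i \<notin> B"
        | "card B mod 3 = c" "card A mod 3 = (c + 1) mod 3"
        using mem by (auto simp: coord_set_def)
      then show False
      proof cases
        case 1
        then show False using * by (simp add: mod_Suc split: if_splits)
      next
        case 2
        then show False using * by auto
      next
        case 3
        then show False using * by (simp add: mod_Suc split: if_splits)
      qed
    next
      case 2
      then show False using * mem level_family_no_consecutive[of W K "card A"] by auto
    next
      case 3
      then show False using * mem by simp
    qed
  qed
  then show ?thesis using assms by (auto simp: hypercube_arc_iff)
qed

lemma coord_set_in_cube_cover:
  assumes "i \<in> {1..n}"
  shows "coord_set n i (c mod 3) \<in> cube_cover n K"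
proof -
  have "(i, c mod 3) \<in> {1..n} \<times> {..<3}" using assms by simp
  then show ?thesis unfolding cube_cover_def by blast
qed

lemma cube_cover_covers:
  assumes "1 < K" "n < 2 ^ K" "A \<subseteq> {1..n}" "B \<subseteq> {1..n}" "(A, B) \<notin> parcs (hypercube n)"
  shows "\<exists>I\<in>cube_cover n K. A \<in> I \<and> B \<in> I"
proof -
  have consecutive: "\<exists>I\<in>cube_cover n K. A \<in> I \<and> B \<in> I"
    if "A \<subseteq> {1..n}" "B \<subseteq> {1..n}" "\<not> A \<subseteq> B" "card B = Suc (card A)" for A B
  proof -
    obtain i where i: "i \<in> A" "i \<notin> B" using \<open>\<not> A \<subseteq> B\<close> by blast
    have "A \<in> coord_set n i (card A mod 3)" "B \<in> coord_set n i (card A mod 3)"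
      using i that by (auto simp: coord_set_def mod_simps)
    moreover have "i \<in> {1..n}" using i that by blast
    ultimately show ?thesis using coord_set_in_cube_cover by blast
  qed
  consider "card B = Suc (card A)" | "card A = Suc (card B)"
    | "card B \<noteq> Suc (card A)" "card A \<noteq> Suc (card B)" by blast
  then show ?thesis
  proof cases
    case 1
    then show ?thesis using consecutive[of A B] assms by (auto simp: hypercube_arc_iff)
  next
    case 2
    then show ?thesis using consecutive[of B A] assms by (auto simp: hypercube_arc_iff)
  next
    case 3
    have "card A \<le> n" "card B \<le> n"
      using card_mono[OF _ assms(3)] card_mono[OF _ assms(4)] by simp_all
    then obtain W where "W \<in> level_family K" "card A \<in> W" "card B \<in> W"
      using level_family_covers[of "card A" K "card B"] 3 assms(1,2) by auto
    moreover from this(1) have "{X \<in> Pow {1..n}. card X \<in> W} \<in> cube_cover n K"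
      unfolding cube_cover_def by blast
    ultimately show ?thesis
      using assms(3,4) by (intro bexI[of _ "{X \<in> Pow {1..n}. card X \<in> W}"]) simp_all
  qed
qed

lemma cube_cover_separates:
  assumes "A \<subseteq> {1..n}" "B \<subseteq> {1..n}" and eq: "\<And>I. I \<in> cube_cover n K \<Longrightarrow> A \<in> I \<longleftrightarrow> B \<in> I"
  shows "A = B"
proof (cases "A = {} \<or> B = {}")
  case True
  then show ?thesis using eq[of "{{}}"] by (auto simp: cube_cover_def)
next
  case False
  have coord: "A \<in> coord_set n i (c mod 3) \<longleftrightarrow> B \<in> coord_set n i (c mod 3)"
    if "i \<in> {1..n}" for i c
    using that by (intro eq coord_set_in_cube_cover)
  obtain i j where ij: "i \<in> A" "j \<in> B" using False by blast
  \<comment> \<open>\<open>A\<close> lies in the set for \<open>i\<close> and its own residue, hence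
    so does \<open>B\<close>. With the roles exchanged, each residue equals or follows the other, so
    they agree.\<close>
  have "card B mod 3 = card A mod 3 \<or> card B mod 3 = (card A + 1) mod 3"
    using coord[of i "card A"] ij assms(1,2) by (auto simp: coord_set_def mod_simps)
  moreover have "card A mod 3 = card B mod 3 \<or> card A mod 3 = (card B + 1) mod 3"
    using coord[of j "card B"] ij assms(1,2) by (auto simp: coord_set_def mod_simps)
  ultimately have mod_eq: "card B mod 3 = card A mod 3" by presburger
  \<comment> \<open>This rules out the second disjunct of \<open>coord_set\<close>, so membership
    just tests \<open>i\<close>.\<close>
  have "card A mod 3 \<noteq> (card A + 1) mod 3" by presburger
  then have "i \<in> A \<longleftrightarrow> i \<in> B" if "i \<in> {1..n}" for i
    using coord[OF that, of "card A"] mod_eq assms(1,2) by (auto simp: coord_set_def mod_simps)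
  then show ?thesis using assms(1,2) by blast
qed

section \<open>The logarithmic bound\<close>

lemma USN_hypercube_le:
  assumes "1 < K" "n < 2 ^ K"
  shows "USN (hypercube n) \<le> 3 * n + 2 * K + 3"
proof -
  have "USN (hypercube n) \<le> card (cube_cover n K)"
  proof (rule USN_le_card_independent_cover)
    fix A B assume *: "A \<in> pverts (hypercube n)" "B \<in> pverts (hypercube n)"
    then have sub: "A \<subseteq> {1..n}" "B \<subseteq> {1..n}" by (auto simp: hypercube_def)
    show "\<exists>I\<in>cube_cover n K. A \<in> I \<and> B \<in> I" if "(A, B) \<notin> parcs (hypercube n)"
      using cube_cover_covers[OF assms sub that] .
    show "\<exists>I\<in>cube_cover n K. (A \<in> I) \<noteq> (B \<in> I)" if "A \<noteq> B"
      using cube_cover_separates[OF sub] that by blast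
  next
    fix A assume "A \<in> pverts (hypercube n)"
    \<comment> \<open>No vertex is adjacent to itself, so the pair of \<open>A\<close> with itself
      is covered.\<close>
    then show "\<exists>I\<in>cube_cover n K. A \<in> I"
      using cube_cover_covers[OF assms, of A A] by (auto simp: hypercube_def)
  qed (auto simp: finite_cube_cover dest: cube_cover_independent)
  then show ?thesis using card_cube_cover[of n K] by linarith
qed

theorem theorem13:
  shows "\<exists>C > (0::real). \<exists>n0 :: nat. \<forall>n \<ge> n0.
           real (USN (hypercube n)) < 3 * real n + C * ln (real n)"
\<comment> \<open>With \<open>K = k + 1\<close> the excess over \<open>3 * n\<close> is at most
  \<open>2 * k + 5\<close>. Both \<open>k\<close> and 1 are at most \<open>ln n / ln 2\<close>, so 7
  times this suffices, and 8 makes the inequality strict.\<close>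
proof (intro exI[of _ "8 / ln 2"] exI[of _ "2::nat"] conjI allI impI)
  fix n :: nat assume n: "2 \<le> n"
  obtain k where k: "2 ^ k \<le> n" "n < 2 ^ (k + 1)"
    using ex_power_ivl1[of 2 n] n by auto
  have "1 < k + 1" using k n by (cases k) auto
  then have "real (USN (hypercube n)) \<le> 3 * n + 2 * real k + 5"
    using USN_hypercube_le[of "k + 1" n] k(2) by simp
  moreover have "k \<le> ln n / ln 2"
  proof -
    have "ln (2 ^ k) \<le> ln (real n)"
      using k(1) n by (subst ln_le_cancel_iff) (auto simp flip: of_nat_le_iff)
    then show ?thesis by (simp add: ln_realpow field_simps)
  qed
  moreover have "1 \<le> ln n / ln 2" using n by simp
  ultimately show "real (USN (hypercube n)) < 3 * real n + 8 / ln 2 * ln (real n)"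
    unfolding times_divide_eq_left times_divide_eq_right[symmetric] by linarith
qed simp

end
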